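(* Let $X$ be a complete metric space and let $f:\mathbb{R}\to X$ be an almost periodic map. Then $\mathfrak{M}_f=\mathcal{E}_f$.
   Context: Maps are continuous. A map $f:\mathbb{R}\to X$ into a metric space $(X,d)$ is almost periodic if for every $\varepsilon>0$ the set of $\tau\in\mathbb{R}$ with $\sup_{t}d(f(t),f(t+\tau))\le\varepsilon$ is relatively dense, i.e. there is $L>0$ such that every interval $(r,r+L)$ meets it. Let $S^1=\mathbb{R}/\mathbb{Z}$ with quotient map $\pi:\mathbb{R}\to S^1$. An $f$-sequence is a sequence $\{t_i\}$ of reals such that $\{f(t_i)\}$ converges in $X$. For almost periodic $f$, $\mathfrak{M}_f$ denotes the countable subgroup of $(\mathbb{R},+)$, known to exist and to be uniquely determined by $f$, such that for every sequence $\{t_i\}$ of reals: $\{t_i\}$ is an $f$-sequence if and only if $\{\pi(\lambda t_i)\}$ converges in $S^1$ for all $\lambda\in\mathfrak{M}_f$. The group of exponents of $f$ is $\mathcal{E}_f=\{\alpha\in\mathbb{R}:\{\pi(\alpha t_i)\}\text{ converges in }S^1\text{ for all }f\text{-sequences }\{t_i\}\}$. *)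

theory Defs
  imports "HOL-Analysis.Analysis"
begin

definition relatively_dense :: "real set \<Rightarrow> bool" where
  "relatively_dense T \<longleftrightarrow> (\<exists>L>0. \<forall>r. {r<..<r + L} \<inter> T \<noteq> {})"

(* The pointwise bound is "sup_t d(f(t), f(t + tau)) <= e"; a SUP over the reals
   would have an unspecified value on unbounded sets. *)
definition almost_periodic :: "(real \<Rightarrow> 'a::metric_space) \<Rightarrow> bool" where
  "almost_periodic f \<longleftrightarrow> continuous_on UNIV f \<and>
     (\<forall>e>0. relatively_dense {\<tau>. \<forall>t. dist (f t) (f (t + \<tau>)) \<le> e})"

quotient_type circle = real / "\<lambda>x y. x - y \<in> \<int>"
  morphisms circle_rep circle_proj
proof (rule equivpI)
  show "reflp (\<lambda>x y::real. x - y \<in> \<int>)"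
    by (simp add: reflp_def)
  show "symp (\<lambda>x y::real. x - y \<in> \<int>)"
    by (metis (no_types, lifting) Ints_minus minus_diff_eq sympI)
  show "transp (\<lambda>x y::real. x - y \<in> \<int>)"
  proof (rule transpI)
    fix x y z :: real
    assume "x - y \<in> \<int>" "y - z \<in> \<int>"
    from Ints_add[OF this] show "x - z \<in> \<int>" by simp
  qed
qed

(* The quotient topology of circle_proj. *)
instantiation circle :: topological_space
begin

definition open_circle :: "circle set \<Rightarrow> bool" where
  "open_circle U \<longleftrightarrow> open (circle_proj -` U)"

instance
proof
  show "open (UNIV :: circle set)"
    by (simp add: open_circle_def)
  show "open (S \<inter> T)" if "open S" "open T" for S T :: "circle set"
    using that by (simp add: open_circle_def vimage_Int open_Int)
  show "open (\<Union>K)" if "\<forall>S\<in>K. open S" for K :: "circle set set"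
    using that by (auto simp add: open_circle_def vimage_Union intro: open_UN)
qed

end

definition f_sequence :: "(real \<Rightarrow> 'a::topological_space) \<Rightarrow> (nat \<Rightarrow> real) \<Rightarrow> bool" where
  "f_sequence f t \<longleftrightarrow> convergent (\<lambda>i. f (t i))"

definition additive_real_subgroup :: "real set \<Rightarrow> bool" where
  "additive_real_subgroup M \<longleftrightarrow>
     0 \<in> M \<and> (\<forall>x\<in>M. \<forall>y\<in>M. x + y \<in> M) \<and> (\<forall>x\<in>M. - x \<in> M)"

(* "M is the group M_f". The group is introduced by its defining property, as a
   predicate instead of by definite description, so that no existence or uniqueness
   claim is built into the notation. *)
definition is_module_of :: "(real \<Rightarrow> 'a::topological_space) \<Rightarrow> real set \<Rightarrow> bool" where
  "is_module_of f M \<longleftrightarrow> countable M \<and> additive_real_subgroup M \<and>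
     (\<forall>t. f_sequence f t \<longleftrightarrow> (\<forall>l\<in>M. convergent (\<lambda>i. circle_proj (l * t i))))"

definition exponent_group :: "(real \<Rightarrow> 'a::topological_space) \<Rightarrow> real set" where
  "exponent_group f =
     {\<alpha>. \<forall>t. f_sequence f t \<longrightarrow> convergent (\<lambda>i. circle_proj (\<alpha> * t i))}"

end

theory Submission
  imports Defs
begin

text \<open>
  Only the inclusion of the exponent group in \<open>M\<close> needs an argument. If \<open>\<alpha> \<notin> M\<close>, there are \<open>t\<close> for
  which \<open>\<lambda> t\<close> is almost an integer for finitely many given \<open>\<lambda> \<in> M\<close> while \<open>\<alpha> t\<close> is far from the
  integers: otherwise \<open>cos (2 \<pi> \<alpha> t) \<ge> 1/2\<close> wherever \<open>W t = 1 + (\<Sum>\<lambda>. 1 + cos (2 \<pi> \<lambda> t))\<close> is nearly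
  maximal, so for large \<open>p\<close> a finite sum of translates of \<open>W t ^ p * cos (2 \<pi> \<alpha> t)\<close> is bounded below
  by a positive constant. But all frequencies of this trigonometric polynomial lie in the coset
  \<open>\<alpha> + M\<close> or its negative and are therefore nonzero, so it has a bounded antiderivative, which is absurd. Interleaving
  such \<open>t\<close>, for growing finite subsets of the countable group \<open>M\<close>, with zeros gives an
  \<open>f\<close>-sequence along which \<open>\<alpha> t\<close> diverges modulo 1.
\<close>

section \<open>Functions with a bounded antiderivative\<close>

text \<open>Stands in for vanishing mean value: a bounded antiderivative makes the averages over
  long intervals tend to 0, and no integrals have to be handled.\<close>

definition has_bounded_antiderivative :: "(real \<Rightarrow> real) \<Rightarrow> bool" where
  "has_bounded_antiderivative f \<longleftrightarrow>
     (\<exists>F B. (\<forall>t. (F has_real_derivative f t) (at t)) \<and> (\<forall>t. \<bar>F t\<bar> \<le> B))"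

lemma has_bounded_antiderivativeI:
  assumes "\<And>t. (F has_real_derivative f t) (at t)" "\<And>t. \<bar>F t\<bar> \<le> B"
  shows "has_bounded_antiderivative f"
  using assms unfolding has_bounded_antiderivative_def by blast

lemma has_bounded_antiderivative_add:
  assumes "has_bounded_antiderivative f" "has_bounded_antiderivative g"
  shows "has_bounded_antiderivative (\<lambda>t. f t + g t)"
proof -
  obtain F A where F: "\<And>t. (F has_real_derivative f t) (at t)" "\<And>t. \<bar>F t\<bar> \<le> A"
    using assms(1) unfolding has_bounded_antiderivative_def by blast
  obtain G B where G: "\<And>t. (G has_real_derivative g t) (at t)" "\<And>t. \<bar>G t\<bar> \<le> B"
    using assms(2) unfolding has_bounded_antiderivative_def by blast
  show ?thesis
  proof (rule has_bounded_antiderivativeI)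
    show "((\<lambda>t. F t + G t) has_real_derivative f t + g t) (at t)" for t
      by (intro DERIV_add F G)
    show "\<bar>F t + G t\<bar> \<le> A + B" for t
      using F(2)[of t] G(2)[of t] by linarith
  qed
qed

lemma has_bounded_antiderivative_cmult:
  assumes "has_bounded_antiderivative f"
  shows "has_bounded_antiderivative (\<lambda>t. c * f t)"
proof -
  obtain F A where F: "\<And>t. (F has_real_derivative f t) (at t)" "\<And>t. \<bar>F t\<bar> \<le> A"
    using assms(1) unfolding has_bounded_antiderivative_def by blast
  show ?thesis
  proof (rule has_bounded_antiderivativeI)
    show "((\<lambda>t. c * F t) has_real_derivative c * f t) (at t)" for t
      by (intro DERIV_cmult F)
    show "\<bar>c * F t\<bar> \<le> \<bar>c\<bar> * A" for t
      using F(2)[of t] by (simp add: abs_mult mult_left_mono)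
  qed
qed

lemma has_bounded_antiderivative_zero: "has_bounded_antiderivative (\<lambda>t. 0)"
  by (rule has_bounded_antiderivativeI[of "\<lambda>t. 0" _ 0]) auto

lemma has_bounded_antiderivative_sum:
  assumes "\<And>i. i \<in> I \<Longrightarrow> has_bounded_antiderivative (f i)"
  shows "has_bounded_antiderivative (\<lambda>t. \<Sum>i\<in>I. f i t)"
  using assms
  by (induction I rule: infinite_finite_induct)
    (auto intro: has_bounded_antiderivative_zero has_bounded_antiderivative_add)

lemma has_bounded_antiderivative_cos:
  assumes "a \<noteq> 0"
  shows "has_bounded_antiderivative (\<lambda>t. cos (a * t + b))"
proof (rule has_bounded_antiderivativeI)
  show "((\<lambda>t. sin (a * t + b) / a) has_real_derivative cos (a * t + b)) (at t)" for t
    using assms by (auto intro!: derivative_eq_intros)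
  show "\<bar>sin (a * t + b) / a\<bar> \<le> 1 / \<bar>a\<bar>" for t
    by (simp add: divide_right_mono)
qed

lemma not_has_bounded_antiderivative:
  assumes "c > 0" "\<And>t. f t \<ge> c"
  shows "\<not> has_bounded_antiderivative f"
proof
  assume "has_bounded_antiderivative f"
  then obtain F B where F: "\<And>t. (F has_real_derivative f t) (at t)" "\<And>t. \<bar>F t\<bar> \<le> B"
    unfolding has_bounded_antiderivative_def by blast
  have "B \<ge> 0" using F(2)[of 0] by linarith
  \<comment> \<open>An antiderivative bounded by \<open>B\<close> varies by at most
    \<open>2 * B\<close>, but slope at least \<open>c\<close> over length \<open>T\<close> raises it
    by \<open>2 * B + 1\<close>.\<close>
  define T where "T = (2 * B + 1) / c"
  have T: "T > 0" using \<open>B \<ge> 0\<close> assms(1) by (simp add: T_def)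
  obtain z where z: "F T - F 0 = (T - 0) * f z"
    using MVT2[OF T, of F f] F(1) by blast
  have "T * c \<le> T * f z" using T assms(2) by (simp add: mult_left_mono)
  moreover have "T * c = 2 * B + 1" using assms(1) by (simp add: T_def)
  ultimately show False using z F(2)[of T] F(2)[of 0] by auto
qed

section \<open>Trigonometric polynomials with frequencies in a subgroup\<close>

text \<open>A form of the condition that the Fourier-Bohr coefficients of \<open>f\<close> vanish
  outside \<open>M\<close>. The free phase \<open>b\<close> covers sines as well and absorbs the
  phases that products and translations create.\<close>

definition no_frequency_outside :: "real set \<Rightarrow> (real \<Rightarrow> real) \<Rightarrow> bool" where
  "no_frequency_outside M f \<longleftrightarrow>
     (\<forall>a b. a \<notin> M \<longrightarrow> has_bounded_antiderivative (\<lambda>t. f t * cos (2 * pi * a * t + b)))"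

lemma no_frequency_outside_one:
  assumes "0 \<in> M"
  shows "no_frequency_outside M (\<lambda>t. 1)"
  unfolding no_frequency_outside_def
proof (intro allI impI)
  fix a b :: real
  assume "a \<notin> M"
  then have "2 * pi * a \<noteq> 0" using assms by auto
  from has_bounded_antiderivative_cos[OF this, of b]
  show "has_bounded_antiderivative (\<lambda>t. 1 * cos (2 * pi * a * t + b))" by simp
qed

lemma no_frequency_outside_add:
  assumes "no_frequency_outside M f" "no_frequency_outside M g"
  shows "no_frequency_outside M (\<lambda>t. f t + g t)"
  using assms unfolding no_frequency_outside_def distrib_right
  by (intro allI impI has_bounded_antiderivative_add) auto

lemma no_frequency_outside_sum:
  assumes "\<And>i. i \<in> I \<Longrightarrow> no_frequency_outside M (f i)"
  shows "no_frequency_outside M (\<lambda>t. \<Sum>i\<in>I. f i t)"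
  using assms unfolding no_frequency_outside_def sum_distrib_right
  by (intro allI impI has_bounded_antiderivative_sum) auto

text \<open>The product-to-sum formula replaces the test frequency \<open>a\<close> by
  \<open>a - l\<close> and \<open>a + l\<close>, and these stay outside the subgroup
  \<open>M\<close>.\<close>

lemma no_frequency_outside_mult_cos:
  assumes M: "additive_real_subgroup M" and l: "l \<in> M" and f: "no_frequency_outside M f"
  shows "no_frequency_outside M (\<lambda>t. f t * cos (2 * pi * l * t + d))"
  unfolding no_frequency_outside_def
proof (intro allI impI)
  fix a b :: real
  assume a: "a \<notin> M"
  have "a + l \<notin> M"
  proof
    assume "a + l \<in> M"
    then have "(a + l) + - l \<in> M" using M l unfolding additive_real_subgroup_def by blast
    then show False using a by simp
  qed
  moreover have "a - l \<notin> M"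
  proof
    assume "a - l \<in> M"
    then have "(a - l) + l \<in> M" using M l unfolding additive_real_subgroup_def by blast
    then show False using a by simp
  qed
  ultimately have *: "has_bounded_antiderivative (\<lambda>t. 1/2 *
      (f t * cos (2 * pi * (a - l) * t + (b - d)) + f t * cos (2 * pi * (a + l) * t + (b + d))))"
    using f unfolding no_frequency_outside_def
    by (intro has_bounded_antiderivative_cmult has_bounded_antiderivative_add) auto
  have eq: "1/2 * (f t * cos (2 * pi * (a - l) * t + (b - d)) + f t * cos (2 * pi * (a + l) * t + (b + d)))
     = f t * cos (2 * pi * l * t + d) * cos (2 * pi * a * t + b)" for t
  proof -
    have 1: "2 * pi * (a - l) * t + (b - d) = (2 * pi * a * t + b) - (2 * pi * l * t + d)"
      "2 * pi * (a + l) * t + (b + d) = (2 * pi * a * t + b) + (2 * pi * l * t + d)"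
      by (simp_all add: algebra_simps)
    show ?thesis unfolding 1 cos_add cos_diff by (simp add: algebra_simps)
  qed
  show "has_bounded_antiderivative (\<lambda>t. f t * cos (2 * pi * l * t + d) * cos (2 * pi * a * t + b))"
    using * unfolding eq .
qed

text \<open>One factor is expanded at a time; the translation by \<open>c\<close> only contributes
  the phase \<open>- (2 * pi * l * c)\<close> to each cosine.\<close>

lemma no_frequency_outside_power:
  assumes M: "additive_real_subgroup M" and F: "F \<subseteq> M"
  shows "no_frequency_outside M (\<lambda>t. (1 + (\<Sum>l\<in>F. 1 + cos (2 * pi * l * (t - c)))) ^ p)"
proof (induction p)
  case 0
  show ?case using no_frequency_outside_one M by (simp add: additive_real_subgroup_def)
next
  case (Suc p)
  let ?g = "\<lambda>t. (1 + (\<Sum>l\<in>F. 1 + cos (2 * pi * l * (t - c)))) ^ p"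
  have "no_frequency_outside M
      (\<lambda>t. ?g t + (\<Sum>l\<in>F. ?g t + ?g t * cos (2 * pi * l * t + - (2 * pi * l * c))))"
    using F by (intro no_frequency_outside_add no_frequency_outside_sum
        no_frequency_outside_mult_cos[OF M] Suc) auto
  moreover have "?g t + (\<Sum>l\<in>F. ?g t + ?g t * cos (2 * pi * l * t + - (2 * pi * l * c)))
      = (1 + (\<Sum>l\<in>F. 1 + cos (2 * pi * l * (t - c)))) ^ Suc p" for t
  proof -
    have "?g t + ?g t * cos (2 * pi * l * t + - (2 * pi * l * c))
        = ?g t * (1 + cos (2 * pi * l * (t - c)))" for l
      by (simp only: distrib_left mult_1_right right_diff_distrib add_uminus_conv_diff)
    then show ?thesis
      by (simp only: power_Suc2 distrib_left mult_1_right sum_distrib_left)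
  qed
  ultimately show ?case by simp
qed

section \<open>Simultaneous approximation and the separating real\<close>

lemma cos_2pi_cong_Ints:
  assumes "x - y \<in> \<int>"
  shows "cos (2 * pi * x) = cos (2 * pi * y)"
proof -
  obtain k where "x - y = of_int k" using assms by (auto elim: Ints_cases)
  then have "2 * pi * x = 2 * pi * y + 2 * pi * of_int k" by (simp add: algebra_simps)
  then show ?thesis by (simp only: cos_add cos_int_2pin sin_int_2pin mult_zero_right mult_1_right diff_zero)
qed

text \<open>Pigeonhole: \<open>cell\<close> sorts the fractional parts of \<open>l * t\<close>, for
  \<open>l\<close> in \<open>F\<close>, into boxes of side \<open>1 / N\<close>. Finitely many boxes
  occur, and \<open>C\<close> holds one real for each. If \<open>t\<close> and \<open>c\<close>
  share a box, every \<open>l * (t - c)\<close> is within \<open>d\<close> of an integer.\<close>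

lemma finite_translates_cover:
  fixes F :: "real set"
  assumes F: "finite F" and e: "e > 0"
  obtains C :: "real set" where "finite C"
    and "\<And>t. \<exists>c\<in>C. \<forall>l\<in>F. cos (2 * pi * l * (t - c)) \<ge> 1 - e"
proof -
  have "\<forall>\<^sub>F x in at 0. cos (2 * pi * x) > 1 - e"
  proof -
    have "((\<lambda>x::real. cos (2 * pi * x)) \<longlongrightarrow> cos (2 * pi * 0)) (at 0)"
      by (intro tendsto_intros)
    then show ?thesis using e by (intro order_tendstoD) auto
  qed
  then obtain d where d: "d > 0" "\<And>x. x \<noteq> 0 \<Longrightarrow> \<bar>x\<bar> < d \<Longrightarrow> cos (2 * pi * x) > 1 - e"
    unfolding eventually_at by (auto simp: dist_real_def)
  obtain N :: nat where N: "N > 0" "1 / N < d"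
    using d(1) by (metis nat_approx_posE of_nat_0_less_iff of_nat_Suc zero_less_Suc)
  define cell where "cell t = (\<lambda>l\<in>F. \<lfloor>N * frac (l * t)\<rfloor>)" for t :: real
  have "range cell \<subseteq> PiE F (\<lambda>_. {0..<int N})"
  proof (rule image_subsetI)
    fix t
    have "0 \<le> \<lfloor>N * frac (l * t)\<rfloor> \<and> \<lfloor>N * frac (l * t)\<rfloor> < int N" for l
      using N(1) frac_lt_1[of "l * t"] frac_ge_0[of "l * t"] by (simp add: floor_less_iff)
    then show "cell t \<in> PiE F (\<lambda>_. {0..<int N})" unfolding cell_def by auto
  qed
  then have fin: "finite (range cell)"
    using F by (meson finite_PiE finite_atLeastLessThan_int finite_subset)
  define C where "C = inv cell ` range cell"
  show ?thesis
  proof (rule that)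
    show "finite C" using fin by (simp add: C_def)
    fix t
    let ?c = "inv cell (cell t)"
    have c: "cell ?c = cell t" by (simp add: f_inv_into_f)
    have "cos (2 * pi * l * (t - ?c)) \<ge> 1 - e" if l: "l \<in> F" for l
    proof -
      have "\<lfloor>N * frac (l * t)\<rfloor> = \<lfloor>N * frac (l * ?c)\<rfloor>"
        using fun_cong[OF c, of l] l by (simp add: cell_def)
      then have "\<bar>N * frac (l * t) - N * frac (l * ?c)\<bar> < 1" by linarith
      then have "N * \<bar>frac (l * t) - frac (l * ?c)\<bar> < 1"
        by (simp add: abs_mult flip: right_diff_distrib)
      then have "\<bar>frac (l * t) - frac (l * ?c)\<bar> < 1 / N"
        using N(1) by (simp add: field_simps)
      then have small: "\<bar>frac (l * t) - frac (l * ?c)\<bar> < d" using N(2) by linarith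
      have "l * (t - ?c) - (frac (l * t) - frac (l * ?c)) = of_int (\<lfloor>l * t\<rfloor> - \<lfloor>l * ?c\<rfloor>)"
        by (simp add: frac_def algebra_simps)
      then have "cos (2 * pi * (l * (t - ?c))) = cos (2 * pi * (frac (l * t) - frac (l * ?c)))"
        by (intro cos_2pi_cong_Ints) (simp only: Ints_of_int)
      \<comment> \<open>The constant \<open>d\<close> comes from a punctured neighbourhood of 0, so
        equal fractional parts form a separate case.\<close>
      moreover have "cos (2 * pi * (frac (l * t) - frac (l * ?c))) \<ge> 1 - e"
        using d(2)[of "frac (l * t) - frac (l * ?c)"] small e
        by (cases "frac (l * t) = frac (l * ?c)") auto
      ultimately show ?thesis by (simp add: mult.assoc)
    qed
    then show "\<exists>c\<in>C. \<forall>l\<in>F. cos (2 * pi * l * (t - c)) \<ge> 1 - e"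
      by (auto simp: C_def)
  qed
qed

lemma exists_separating_real:
  assumes M: "additive_real_subgroup M" and F: "finite F" "F \<subseteq> M"
    and a: "a \<notin> M" and e: "e > 0"
  shows "\<exists>t. (\<forall>l\<in>F. cos (2 * pi * l * t) \<ge> 1 - e) \<and> cos (2 * pi * a * t) < 1/2"
proof (rule ccontr)
  assume neg: "\<not> ?thesis"
  define W where "W t = 1 + (\<Sum>l\<in>F. 1 + cos (2 * pi * l * t))" for t :: real
  \<comment> \<open>\<open>A\<close> is the maximum of \<open>W\<close>, attained at 0. Below it lie
    two thresholds: \<open>W t \<ge> q\<close> will force every cosine to be at least
    \<open>1 - e\<close>, and for each \<open>t\<close> some \<open>W (t - c)\<close> with
    \<open>c\<close> in \<open>C\<close> will reach \<open>r\<close>. The bound 1/2 on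
    \<open>e'\<close> keeps \<open>q\<close> positive.\<close>
  define A :: real where "A = 1 + 2 * card F"
  define e' where "e' = min e (1/2)"
  define q where "q = A - e'"
  define r where "r = A - e' / 2"
  have e': "e' > 0" "e' \<le> e" "e' \<le> 1/2" using e by (auto simp: e'_def)
  have "A \<ge> 1" by (simp add: A_def)
  then have qr: "0 < q" "q < r" using e' by (auto simp: q_def r_def)
  have cos1: "1 + cos x \<ge> 0" "1 + cos x \<le> 2" for x :: real
    using cos_ge_minus_one[of x] cos_le_one[of x] by linarith+
  have W0: "W t \<ge> 0" for t
  proof -
    have "(\<Sum>l\<in>F. 1 + cos (2 * pi * l * t)) \<ge> 0" by (intro sum_nonneg cos1)
    then show ?thesis by (simp add: W_def)
  qed
  have Wq: "cos (2 * pi * a * t) \<ge> 1/2" if t: "W t \<ge> q" for t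
  proof -
    have "cos (2 * pi * l * t) \<ge> 1 - e" if l: "l \<in> F" for l
    proof -
      \<comment> \<open>All other summands are at most 2, so the deficit of a single cosine cannot
        exceed the total deficit \<open>A - W t \<le> e'\<close>.\<close>
      have "(\<Sum>k\<in>F - {l}. 1 + cos (2 * pi * k * t)) \<le> (\<Sum>k\<in>F - {l}. 2)"
        using cos1 by (intro sum_mono) auto
      also have "\<dots> = 2 * card F - 2"
        using F l by (simp add: card_Diff_singleton_if algebra_simps)
      finally have "(\<Sum>k\<in>F - {l}. 1 + cos (2 * pi * k * t)) \<le> 2 * real (card F) - 2"
        using F l card_gt_0_iff[of F] by (auto simp: of_nat_diff)
      moreover have "W t = 1 + (1 + cos (2 * pi * l * t)) + (\<Sum>k\<in>F - {l}. 1 + cos (2 * pi * k * t))"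
        unfolding W_def using F l by (subst sum.remove[of F l]) auto
      ultimately show ?thesis using t e' by (simp add: q_def A_def)
    qed
    then show ?thesis using neg by (meson not_le)
  qed
  \<comment> \<open>Where \<open>W t < q\<close>, replacing the factor 1/2 by the worst case -1
    costs \<open>3/2 * W t ^ p\<close>, which is at most \<open>3/2 * q ^ p\<close>.\<close>
  have low: "W t ^ p * cos (2 * pi * a * t) \<ge> W t ^ p / 2 - 3/2 * q ^ p" for t p
  proof (cases "W t \<ge> q")
    case True
    have "W t ^ p * (1/2) \<le> W t ^ p * cos (2 * pi * a * t)"
      using Wq[OF True] W0 by (intro mult_left_mono) auto
    moreover have "q ^ p \<ge> 0" using qr by simp
    ultimately show ?thesis by linarith
  next
    case False
    have "W t ^ p * (-1) \<le> W t ^ p * cos (2 * pi * a * t)"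
      using W0 by (intro mult_left_mono) auto
    moreover have "W t ^ p \<le> q ^ p" using False W0 by (intro power_mono) auto
    ultimately show ?thesis by linarith
  qed
  \<comment> \<open>The allowance \<open>e' / 2\<close> is shared among the cosines; the added 1
    keeps the denominator nonzero for empty \<open>F\<close>.\<close>
  define d where "d = e' / (2 * (card F + 1))"
  have d: "d > 0" "card F * d \<le> e' / 2"
    using e' by (auto simp: d_def field_simps)
  obtain C :: "real set" where C: "finite C"
    "\<And>t. \<exists>c\<in>C. \<forall>l\<in>F. cos (2 * pi * l * (t - c)) \<ge> 1 - d"
    using finite_translates_cover[OF F(1) d(1)] by metis
  have Wr: "\<exists>c\<in>C. W (t - c) \<ge> r" for t
  proof -
    obtain c where c: "c \<in> C" "\<And>l. l \<in> F \<Longrightarrow> cos (2 * pi * l * (t - c)) \<ge> 1 - d"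
      using C(2) by blast
    have "(\<Sum>l\<in>F. 2 - d) \<le> (\<Sum>l\<in>F. 1 + cos (2 * pi * l * (t - c)))"
      using c(2) by (intro sum_mono) force
    then have "W (t - c) \<ge> r" using d(2) by (simp add: W_def r_def A_def algebra_simps)
    then show ?thesis using c(1) by blast
  qed
  \<comment> \<open>One translate gains \<open>r ^ p / 2\<close>, while all of them together lose at
    most \<open>card C * (3/2 * q ^ p)\<close>; since \<open>q < r\<close>, a large \<open>p\<close>
    makes the gain prevail.\<close>
  obtain p where p: "3 * card C < (r / q) ^ p"
    using real_arch_pow[of "r / q"] qr by auto
  have p': "3 * card C * q ^ p < r ^ p"
    using p qr by (simp add: power_divide field_simps)
  let ?h = "\<lambda>t. \<Sum>c\<in>C. W (t - c) ^ p * cos (2 * pi * a * (t - c))"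
  have "?h t \<ge> (r ^ p - 3 * card C * q ^ p) / 2" for t
  proof -
    obtain c where c: "c \<in> C" "W (t - c) \<ge> r" using Wr by blast
    have "r ^ p \<le> W (t - c) ^ p" using c qr by (intro power_mono) auto
    also have "\<dots> \<le> (\<Sum>c\<in>C. W (t - c) ^ p)"
      using c C(1) W0 by (intro member_le_sum) auto
    finally have "r ^ p / 2 - card C * (3/2 * q ^ p) \<le> (\<Sum>c\<in>C. W (t - c) ^ p / 2 - 3/2 * q ^ p)"
      by (simp add: sum_subtractf flip: sum_divide_distrib)
    also have "\<dots> \<le> ?h t" by (intro sum_mono low)
    finally show ?thesis by (simp add: algebra_simps diff_divide_distrib)
  qed
  then have "\<not> has_bounded_antiderivative ?h"
    using p' by (intro not_has_bounded_antiderivative[of "(r ^ p - 3 * card C * q ^ p) / 2"]) auto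
  moreover have "has_bounded_antiderivative ?h"
  proof (rule has_bounded_antiderivative_sum)
    fix c
    have "has_bounded_antiderivative
        (\<lambda>t. W (t - c) ^ p * cos (2 * pi * a * t + - (2 * pi * a * c)))"
      using no_frequency_outside_power[OF M F(2)] a
      unfolding no_frequency_outside_def W_def by blast
    then show "has_bounded_antiderivative (\<lambda>t. W (t - c) ^ p * cos (2 * pi * a * (t - c)))"
      by (simp add: right_diff_distrib)
  qed
  ultimately show False by contradiction
qed

section \<open>Convergence in the circle tested by the cosine\<close>

text \<open>\<open>cos (2 * pi * x)\<close> is close to 1 only when \<open>x\<close> is close to an
  integer.\<close>

lemma tendsto_circle_proj_0:
  assumes "(\<lambda>i. cos (2 * pi * x i)) \<longlonglongrightarrow> 1"
  shows "(\<lambda>i. circle_proj (x i)) \<longlonglongrightarrow> circle_proj 0"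
proof (rule topological_tendstoI)
  fix U assume U: "open U" "circle_proj 0 \<in> U"
  then have "open (circle_proj -` U)" "0 \<in> circle_proj -` U"
    by (auto simp: open_circle_def)
  then obtain d where d: "d > 0" "ball 0 d \<subseteq> circle_proj -` U"
    unfolding open_contains_ball by blast
  \<comment> \<open>The cap 1/2 keeps \<open>2 * pi * d'\<close> in the range from 0 to
    \<open>pi\<close>, where the cosine decreases.\<close>
  define d' where "d' = min d (1/2)"
  have d': "0 < d'" "d' \<le> d" "d' \<le> 1/2" using d by (auto simp: d'_def)
  have "cos (2 * pi * d') < cos 0" using d' by (intro cos_monotone_0_pi) auto
  then have "\<forall>\<^sub>F i in sequentially. cos (2 * pi * x i) > cos (2 * pi * d')"
    using assms by (intro order_tendstoD) auto
  then show "\<forall>\<^sub>F i in sequentially. circle_proj (x i) \<in> U"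
  proof eventually_elim
    case (elim i)
    define y where "y = x i - of_int (round (x i))"
    have y: "\<bar>y\<bar> \<le> 1/2" using of_int_round_abs_le[of "x i"] by (simp add: y_def abs_minus_commute)
    have xy: "x i - y \<in> \<int>" by (simp add: y_def)
    have "cos (2 * pi * \<bar>y\<bar>) = cos (2 * pi * y)" by (cases "y \<ge> 0") auto
    then have "cos (2 * pi * \<bar>y\<bar>) > cos (2 * pi * d')"
      using elim cos_2pi_cong_Ints[OF xy] by simp
    moreover have "cos (2 * pi * \<bar>y\<bar>) \<le> cos (2 * pi * d')" if "d' \<le> \<bar>y\<bar>"
      using that y d' by (intro cos_monotone_0_pi_le) auto
    ultimately have "\<bar>y\<bar> < d'" by (meson not_le)
    then have "circle_proj y \<in> U" using d d' by (auto simp: subset_iff)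
    moreover have "circle_proj (x i) = circle_proj y" using xy by (simp add: circle.abs_eq_iff)
    ultimately show ?case by simp
  qed
qed

text \<open>The cosine descends to a function \<open>g\<close> on the circle, independent of the
  representative and continuous for the quotient topology. Divergence in the circle can thus be
  detected on real sequences.\<close>

lemma convergent_cos_if_convergent_circle_proj:
  assumes "convergent (\<lambda>i. circle_proj (x i))"
  shows "convergent (\<lambda>i. cos (2 * pi * x i))"
proof -
  define g where "g c = cos (2 * pi * circle_rep c)" for c
  have g: "g (circle_proj y) = cos (2 * pi * y)" for y
  proof -
    have "circle_proj (circle_rep (circle_proj y)) = circle_proj y"
      by (rule Quotient3_abs_rep[OF Quotient3_circle])
    then show ?thesis unfolding g_def by (intro cos_2pi_cong_Ints) (simp add: circle.abs_eq_iff)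
  qed
  have "open (g -` B)" if "open B" for B
  proof -
    have "circle_proj -` g -` B = (\<lambda>y. cos (2 * pi * y)) -` B" by (auto simp: g)
    moreover have "open ((\<lambda>y::real. cos (2 * pi * y)) -` B)"
      using that by (intro open_vimage continuous_intros)
    ultimately show ?thesis by (simp add: open_circle_def)
  qed
  then have "continuous_on UNIV g" by (simp add: continuous_on_open_vimage)
  moreover obtain c where "(\<lambda>i. circle_proj (x i)) \<longlonglongrightarrow> c"
    using assms by (auto simp: convergent_def)
  ultimately have "(\<lambda>i. g (circle_proj (x i))) \<longlonglongrightarrow> g c"
    by (rule continuous_on_tendsto_compose) auto
  then show ?thesis by (auto simp: g convergent_def)
qed

section \<open>The separating sequence and the equality of the groups\<close>

lemma exists_separating_sequence:
  assumes M: "additive_real_subgroup M" "countable M" and a: "a \<notin> M"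
  obtains t where "\<And>l. l \<in> M \<Longrightarrow> convergent (\<lambda>i. circle_proj (l * t i))"
    and "\<not> convergent (\<lambda>i. circle_proj (a * t i))"
proof -
  have ne: "M \<noteq> {}" using M by (auto simp: additive_real_subgroup_def)
  \<comment> \<open>The \<open>i\<close>-th real handles the first \<open>i + 1\<close> members of
    an enumeration of \<open>M\<close>, which repeats elements if \<open>M\<close> is finite, so
    each fixed \<open>l\<close> is treated from some index on.\<close>
  have "\<forall>i. \<exists>t. (\<forall>l\<in>from_nat_into M ` {..i}. cos (2 * pi * l * t) \<ge> 1 - 1 / real (Suc i))
      \<and> cos (2 * pi * a * t) < 1/2"
    using M a from_nat_into[OF ne] by (intro allI exists_separating_real[of M]) auto
  then obtain u where "\<forall>i. (\<forall>l\<in>from_nat_into M ` {..i}. cos (2 * pi * l * u i) \<ge> 1 - 1 / real (Suc i))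
      \<and> cos (2 * pi * a * u i) < 1/2"
    by (rule choice[THEN exE])
  then have u: "\<And>i j. j \<le> i \<Longrightarrow> cos (2 * pi * from_nat_into M j * u i) \<ge> 1 - 1 / real (Suc i)"
      "\<And>i. cos (2 * pi * a * u i) < 1/2"
    by blast+
  \<comment> \<open>The zeros leave the limit 1 intact for \<open>l\<close> in \<open>M\<close>, but
    for \<open>a\<close> they give cosine 1 at even indices against less than 1/2 at odd
    ones.\<close>
  define t where "t i = (if even i then 0 else u i)" for i
  show ?thesis
  proof (rule that)
    fix l assume "l \<in> M"
    then obtain j where j: "from_nat_into M j = l"
      using from_nat_into_surj[OF M(2)] by blast
    have "(\<lambda>i. cos (2 * pi * (l * t i))) \<longlonglongrightarrow> 1"
    proof (rule tendsto_sandwich)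
      show "\<forall>\<^sub>F i in sequentially. 1 - 1 / real (Suc i) \<le> cos (2 * pi * (l * t i))"
        using eventually_ge_at_top[of j]
        by eventually_elim (use u(1) j in \<open>auto simp: t_def mult.assoc\<close>)
      have "(\<lambda>i. 1 - 1 / real (Suc i)) \<longlonglongrightarrow> 1 - 0"
        using LIMSEQ_Suc[OF lim_1_over_n] by (intro tendsto_intros)
      then show "(\<lambda>i. 1 - 1 / real (Suc i)) \<longlonglongrightarrow> 1" by simp
    qed auto
    then show "convergent (\<lambda>i. circle_proj (l * t i))"
      by (rule tendsto_circle_proj_0[THEN convergentI])
  next
    show "\<not> convergent (\<lambda>i. circle_proj (a * t i))"
    proof
      assume "convergent (\<lambda>i. circle_proj (a * t i))"
      then obtain L where L: "(\<lambda>i. cos (2 * pi * (a * t i))) \<longlonglongrightarrow> L"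
        by (rule convergent_cos_if_convergent_circle_proj[THEN convergentD, THEN exE])
      have "(\<lambda>i. cos (2 * pi * (a * t (2 * i)))) \<longlonglongrightarrow> L"
        using LIMSEQ_subseq_LIMSEQ[OF L, of "\<lambda>i. 2 * i"] by (simp add: strict_mono_def o_def)
      then have "L = 1" by (simp add: t_def LIMSEQ_const_iff)
      moreover have "(\<lambda>i. cos (2 * pi * (a * t (Suc (2 * i))))) \<longlonglongrightarrow> L"
        using LIMSEQ_subseq_LIMSEQ[OF L, of "\<lambda>i. Suc (2 * i)"] by (simp add: strict_mono_def o_def)
      then have "L \<le> 1/2"
        using u(2) by (intro LIMSEQ_le_const2) (auto simp: t_def mult.assoc intro: less_imp_le)
      ultimately show False by simp
    qed
  qed
qed

theorem lemma2p8:
  fixes f :: "real \<Rightarrow> 'a::complete_space" and M :: "real set"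
  assumes "almost_periodic f"
    and "is_module_of f M"
  shows "M = exponent_group f"
proof
  show "M \<subseteq> exponent_group f"
    using assms(2) by (auto simp: is_module_of_def exponent_group_def)
  show "exponent_group f \<subseteq> M"
  proof
    fix a assume a: "a \<in> exponent_group f"
    show "a \<in> M"
    proof (rule ccontr)
      assume "a \<notin> M"
      then obtain t where "\<And>l. l \<in> M \<Longrightarrow> convergent (\<lambda>i. circle_proj (l * t i))"
        and "\<not> convergent (\<lambda>i. circle_proj (a * t i))"
        using exists_separating_sequence assms(2) unfolding is_module_of_def by metis
      \<comment> \<open>The characterization of \<open>M\<close> makes \<open>t\<close> an
        \<open>f\<close>-sequence, along which the exponent \<open>a\<close> would have to
        converge.\<close>
      then show False using a assms(2) unfolding is_module_of_def exponent_group_def by blast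
    qed
  qed
qed

end
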